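(* Let $G$ be a finite abelian group and let $J$ and $K$ be subsets of $G$. Then: 1. If $J$ and $K$ are translates of each other, then $\Phi_J$ and $\Phi_K$ are projectively unitarily equivalent. 2. If $J$ and $K$ are multiplicatively equivalent, then $\Phi_J$ and $\Phi_K$ are unitarily equivalent after reindexing by an automorphism. 3. If $J$ and $K$ are affinely equivalent, then $\Phi_J$ and $\Phi_K$ are projectively unitarily equivalent after reindexing by an automorphism.
   Context: $G$ is written additively, and $\hat G$ is its character group (the irreducible characters $\xi:G\to\mathbb{C}^\times$). For $J\subset G$, the harmonic frame $\Phi_J$ is the sequence of vectors $\Phi_J=(\xi|_J)_{\xi\in\hat G}$ in $\mathbb{C}^J$ (with the Euclidean inner product), indexed by $\hat G$. Sequences $(v_\xi)_{\xi\in\hat G}$ in $\mathbb{C}^J$ and $(w_\xi)_{\xi\in\hat G}$ in $\mathbb{C}^K$ are unitarily equivalent if there is a unitary map $U:\mathbb{C}^J\to\mathbb{C}^K$ with $w_\xi=Uv_\xi$ for all $\xi$, and projectively unitarily equivalent if there are a unitary map $U:\mathbb{C}^J\to\mathbb{C}^K$ and scalars $c_\xi\in\mathbb{C}$, $|c_\xi|=1$, with $w_\xi=c_\xi Uv_\xi$ for all $\xi$. They are (projectively) unitarily equivalent after reindexing by an automorphism if there is a group automorphism $\alpha$ of $\hat G$ such that $(v_\xi)_{\xi\in\hat G}$ and $(w_{\alpha(\xi)})_{\xi\in\hat G}$ are (projectively) unitarily equivalent. $K$ is a translate of $J$ if $K=J-b$ for some $b\in G$. $J$ and $K$ are multiplicatively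 equivalent if $K=\sigma J$ for some automorphism $\sigma$ of $G$. $J$ and $K$ are affinely equivalent if $K=\pi J$ for some map $\pi:G\to G$ of the form $\pi(g)=\sigma(g)-b$ with $\sigma\in\mathrm{Aut}(G)$, $b\in G$. *)

theory Defs
  imports Complex_Main "HOL-Algebra.Group"
begin

text \<open>
  The abelian group is a multiplicatively written \<open>HOL-Algebra\<close> group, so the additive
  \<open>g - b\<close> is rendered as \<open>g \<otimes> inv b\<close>.
\<close>

definition complex_units :: "complex monoid" where
  "complex_units = \<lparr>carrier = UNIV - {0}, mult = (*), one = 1\<rparr>"

text \<open>
  Characters are extensional functions (\<open>undefined\<close> off the carrier), so that each
  homomorphism on the carrier is represented exactly once. The irreducible characters of a
  finite abelian group are its homomorphisms into the multiplicative group of complex numbers.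
\<close>

definition character_group :: "('a, 'm) monoid_scheme \<Rightarrow> ('a \<Rightarrow> complex) monoid" where
  "character_group G =
     \<lparr>carrier = hom G complex_units \<inter> extensional (carrier G),
      mult = (\<lambda>\<xi> \<eta>. \<lambda>g\<in>carrier G. \<xi> g * \<eta> g),
      one = (\<lambda>g\<in>carrier G. 1)\<rparr>"

text \<open>The space of \<open>J\<close>-tuples of complex numbers, again as extensional functions.\<close>

definition cspace :: "'j set \<Rightarrow> ('j \<Rightarrow> complex) set" where
  "cspace J = J \<rightarrow>\<^sub>E UNIV"

definition cinner :: "'j set \<Rightarrow> ('j \<Rightarrow> complex) \<Rightarrow> ('j \<Rightarrow> complex) \<Rightarrow> complex" where
  "cinner J x y = (\<Sum>j\<in>J. x j * cnj (y j))"

definition unitary_map ::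
  "'j set \<Rightarrow> 'k set \<Rightarrow> (('j \<Rightarrow> complex) \<Rightarrow> ('k \<Rightarrow> complex)) \<Rightarrow> bool" where
  "unitary_map J K U \<longleftrightarrow>
     bij_betw U (cspace J) (cspace K) \<and>
     (\<forall>x\<in>cspace J. \<forall>y\<in>cspace J. U (\<lambda>j\<in>J. x j + y j) = (\<lambda>k\<in>K. U x k + U y k)) \<and>
     (\<forall>c. \<forall>x\<in>cspace J. U (\<lambda>j\<in>J. c * x j) = (\<lambda>k\<in>K. c * U x k)) \<and>
     (\<forall>x\<in>cspace J. \<forall>y\<in>cspace J. cinner K (U x) (U y) = cinner J x y)"

text \<open>The harmonic frame of \<open>J\<close> is this family, indexed by the carrier of the character group.\<close>

definition harmonic_frame :: "'a set \<Rightarrow> ('a \<Rightarrow> complex) \<Rightarrow> ('a \<Rightarrow> complex)" where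
  "harmonic_frame J \<xi> = restrict \<xi> J"

definition unitarily_equivalent ::
  "'i set \<Rightarrow> 'j set \<Rightarrow> 'k set \<Rightarrow> ('i \<Rightarrow> 'j \<Rightarrow> complex) \<Rightarrow> ('i \<Rightarrow> 'k \<Rightarrow> complex) \<Rightarrow> bool" where
  "unitarily_equivalent I J K v w \<longleftrightarrow>
     (\<exists>U. unitary_map J K U \<and> (\<forall>i\<in>I. w i = U (v i)))"

definition projectively_unitarily_equivalent ::
  "'i set \<Rightarrow> 'j set \<Rightarrow> 'k set \<Rightarrow> ('i \<Rightarrow> 'j \<Rightarrow> complex) \<Rightarrow> ('i \<Rightarrow> 'k \<Rightarrow> complex) \<Rightarrow> bool" where
  "projectively_unitarily_equivalent I J K v w \<longleftrightarrow>
     (\<exists>U c. unitary_map J K U \<and>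
        (\<forall>i\<in>I. norm (c i :: complex) = 1 \<and> w i = (\<lambda>k\<in>K. c i * U (v i) k)))"

text \<open>In the next two definitions the index set is the carrier of a group \<open>D\<close>.\<close>

definition unitarily_equivalent_reindex ::
  "('i, 'm) monoid_scheme \<Rightarrow> 'j set \<Rightarrow> 'k set \<Rightarrow>
     ('i \<Rightarrow> 'j \<Rightarrow> complex) \<Rightarrow> ('i \<Rightarrow> 'k \<Rightarrow> complex) \<Rightarrow> bool" where
  "unitarily_equivalent_reindex D J K v w \<longleftrightarrow>
     (\<exists>\<alpha>\<in>iso D D. unitarily_equivalent (carrier D) J K v (\<lambda>\<xi>. w (\<alpha> \<xi>)))"

definition projectively_unitarily_equivalent_reindex ::
  "('i, 'm) monoid_scheme \<Rightarrow> 'j set \<Rightarrow> 'k set \<Rightarrow>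
     ('i \<Rightarrow> 'j \<Rightarrow> complex) \<Rightarrow> ('i \<Rightarrow> 'k \<Rightarrow> complex) \<Rightarrow> bool" where
  "projectively_unitarily_equivalent_reindex D J K v w \<longleftrightarrow>
     (\<exists>\<alpha>\<in>iso D D. projectively_unitarily_equivalent (carrier D) J K v (\<lambda>\<xi>. w (\<alpha> \<xi>)))"

definition translate_of :: "('a, 'm) monoid_scheme \<Rightarrow> 'a set \<Rightarrow> 'a set \<Rightarrow> bool" where
  "translate_of G J K \<longleftrightarrow>
     (\<exists>b\<in>carrier G. K = (\<lambda>g. g \<otimes>\<^bsub>G\<^esub> inv\<^bsub>G\<^esub> b) ` J)"

definition multiplicatively_equivalent :: "('a, 'm) monoid_scheme \<Rightarrow> 'a set \<Rightarrow> 'a set \<Rightarrow> bool" where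
  "multiplicatively_equivalent G J K \<longleftrightarrow> (\<exists>\<sigma>\<in>iso G G. K = \<sigma> ` J)"

definition affinely_equivalent :: "('a, 'm) monoid_scheme \<Rightarrow> 'a set \<Rightarrow> 'a set \<Rightarrow> bool" where
  "affinely_equivalent G J K \<longleftrightarrow>
     (\<exists>\<sigma>\<in>iso G G. \<exists>b\<in>carrier G. K = (\<lambda>g. \<sigma> g \<otimes>\<^bsub>G\<^esub> inv\<^bsub>G\<^esub> b) ` J)"

end

theory Submission
  imports Defs "HOL-Algebra.Multiplicative_Group"
begin

text \<open>
  Every character \<open>\<eta>\<close> satisfies \<open>\<eta> (\<sigma> g - b) = \<eta> (- b) * \<eta> (\<sigma> g)\<close>. The factor \<open>\<eta> (- b)\<close> has modulus 1
  and does not depend on \<open>g\<close>, and \<open>\<eta> \<circ> \<sigma>\<close> is again a character. So relabelling coordinates along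
  \<open>g \<mapsto> \<sigma> g - b\<close>, which is a unitary map, carries the frame vector of \<open>\<eta> \<circ> \<sigma>\<close> in \<open>\<complex>\<^sup>J\<close> to a
  unimodular multiple of the frame vector of \<open>\<eta>\<close> in \<open>\<complex>\<^sup>K\<close>; the reindexing automorphism is the inverse
  of \<open>\<eta> \<mapsto> \<eta> \<circ> \<sigma>\<close>.
\<close>

section \<open>Unitary maps obtained by relabelling coordinates\<close>

lemma unitary_map_relabel:
  assumes p: "bij_betw p K J"
  shows "unitary_map J K (\<lambda>x. \<lambda>k\<in>K. x (p k))"
proof -
  let ?U = "\<lambda>x. \<lambda>k\<in>K. (x :: _ \<Rightarrow> complex) (p k)"
  let ?V = "\<lambda>y. \<lambda>j\<in>J. (y :: _ \<Rightarrow> complex) (inv_into K p j)"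
  have pJ: "p k \<in> J" if "k \<in> K" for k
    using p that by (auto simp: bij_betw_def)
  have q: "inv_into K p j \<in> K" "p (inv_into K p j) = j" if "j \<in> J" for j
    using p that by (auto simp: bij_betw_def inv_into_into f_inv_into_f)
  have qp: "inv_into K p (p k) = k" if "k \<in> K" for k
    using p that by (simp add: bij_betw_def)
  \<comment> \<open>Pulling back along \<open>inv_into K p\<close> undoes the relabelling. Both
    sides of each identity are \<open>undefined\<close> off the index set, so it suffices to compare
    them on that set.\<close>
  have "bij_betw ?U (cspace J) (cspace K)"
  proof (rule bij_betw_byWitness[where f' = ?V])
    show "\<forall>x\<in>cspace J. ?V (?U x) = x"
    proof
      fix x :: "'b \<Rightarrow> complex" assume x: "x \<in> cspace J"
      show "?V (?U x) = x"
        by (rule extensionalityI[of _ J]) (use x q in \<open>auto simp: cspace_def PiE_def\<close>)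
    qed
    show "\<forall>y\<in>cspace K. ?U (?V y) = y"
    proof
      fix y :: "'a \<Rightarrow> complex" assume y: "y \<in> cspace K"
      show "?U (?V y) = y"
        by (rule extensionalityI[of _ K]) (use y pJ qp in \<open>auto simp: cspace_def PiE_def\<close>)
    qed
  qed (auto simp: cspace_def)
  moreover have "cinner K (?U x) (?U y) = cinner J x y" for x y
  proof -
    have "cinner K (?U x) (?U y) = (\<Sum>k\<in>K. x (p k) * cnj (y (p k)))"
      unfolding cinner_def by (rule sum.cong) auto
    also have "\<dots> = cinner J x y"
      unfolding cinner_def by (rule sum.reindex_bij_betw[OF p])
    finally show ?thesis .
  qed
  ultimately show ?thesis
    unfolding unitary_map_def by (auto simp: pJ cong: restrict_cong)
qed

lemma unitarily_equivalentI_relabel: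
  assumes "bij_betw p K J" and "\<And>i. i \<in> I \<Longrightarrow> w i = (\<lambda>k\<in>K. v i (p k))"
  shows "unitarily_equivalent I J K v w"
  unfolding unitarily_equivalent_def
  using unitary_map_relabel[OF assms(1)] assms(2)
  by (intro exI[of _ "\<lambda>x. \<lambda>k\<in>K. x (p k)"]) auto

lemma projectively_unitarily_equivalentI_relabel:
  assumes "bij_betw p K J" and "\<And>i. i \<in> I \<Longrightarrow> norm (c i) = 1"
    and "\<And>i. i \<in> I \<Longrightarrow> w i = (\<lambda>k\<in>K. c i * v i (p k))"
  shows "projectively_unitarily_equivalent I J K v w"
  unfolding projectively_unitarily_equivalent_def
  using unitary_map_relabel[OF assms(1)] assms(2,3)
  by (intro exI[of _ "\<lambda>x. \<lambda>k\<in>K. x (p k)"] exI[of _ c]) (auto cong: restrict_cong)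

section \<open>Characters and their pullbacks\<close>

lemma character_mult:
  assumes "\<xi> \<in> carrier (character_group G)" and "x \<in> carrier G" and "y \<in> carrier G"
  shows "\<xi> (x \<otimes>\<^bsub>G\<^esub> y) = \<xi> x * \<xi> y"
  using assms by (auto simp: character_group_def complex_units_def hom_def)

lemma character_nonzero:
  assumes "\<xi> \<in> carrier (character_group G)" and "x \<in> carrier G"
  shows "\<xi> x \<noteq> 0"
  using assms by (auto simp: character_group_def complex_units_def hom_def)

context group
begin

text \<open>The value at \<open>\<one>\<close> equals its own square and is nonzero, so it can be
  cancelled.\<close>

lemma character_one:
  assumes "\<xi> \<in> carrier (character_group G)"
  shows "\<xi> \<one> = 1"
  using character_mult[OF assms, of \<one> \<one>] character_nonzero[OF assms, of \<one>] by simp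

lemma character_pow:
  assumes "\<xi> \<in> carrier (character_group G)" and "x \<in> carrier G"
  shows "\<xi> (x [^] (n::nat)) = \<xi> x ^ n"
  by (induction n) (use assms in \<open>auto simp: character_one character_mult\<close>)

text \<open>In a finite group each element raised to the group order is \<open>\<one>\<close>, so
  character values are roots of unity. This makes the scalars in the projective equivalences
  unimodular.\<close>

lemma norm_character:
  assumes "finite (carrier G)" and "\<xi> \<in> carrier (character_group G)" and "x \<in> carrier G"
  shows "norm (\<xi> x) = 1"
proof -
  have "\<xi> x ^ order G = 1"
    using assms by (metis character_one character_pow pow_order_eq_1)
  \<comment> \<open>From \<open>w ^ n = 1\<close> one gets norm 1 or \<open>n = 0\<close>; this
    excludes the second case.\<close>
  moreover have "order G > 0"
    using assms(1) order_gt_0_iff_finite by blast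
  ultimately show ?thesis
    using power_eq_1_iff[of "\<xi> x" "order G"] by simp
qed

text \<open>The restricted \<open>compose (carrier G)\<close> replaces plain composition so that the
  pullback stays \<open>undefined\<close> off the carrier, as characters are required to be.\<close>

lemma compose_hom_character:
  assumes "\<sigma> \<in> hom G H" and "\<xi> \<in> carrier (character_group H)"
  shows "compose (carrier G) \<xi> \<sigma> \<in> carrier (character_group G)"
  using assms by (auto simp: character_group_def complex_units_def hom_def compose_def Pi_iff)

text \<open>Duality is contravariant: the inverse of pulling back along \<open>\<sigma>\<close> is
  pulling back along its inverse \<open>\<tau>\<close>. Multiplication of characters is pointwise,
  so pullback respects it.\<close>

lemma compose_iso_character_group:
  assumes \<sigma>: "\<sigma> \<in> iso G H" and H: "group H"
  shows "(\<lambda>\<xi>. compose (carrier G) \<xi> \<sigma>) \<in> iso (character_group H) (character_group G)"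
proof -
  define \<tau> where "\<tau> = inv_into (carrier G) \<sigma>"
  have \<tau>: "\<tau> \<in> iso H G"
    unfolding \<tau>_def by (rule iso_set_sym[OF \<sigma>])
  have hom: "\<sigma> \<in> hom G H" "\<tau> \<in> hom H G"
    using \<sigma> \<tau> by (auto simp: iso_def)
  have bij: "bij_betw \<sigma> (carrier G) (carrier H)"
    using \<sigma> by (simp add: iso_def)
  have \<tau>\<sigma>: "\<tau> (\<sigma> g) = g" if "g \<in> carrier G" for g
    using bij that by (simp add: \<tau>_def bij_betw_inv_into_left)
  have \<sigma>\<tau>: "\<sigma> (\<tau> h) = h" if "h \<in> carrier H" for h
    using bij that by (simp add: \<tau>_def bij_betw_inv_into_right)
  have "bij_betw (\<lambda>\<xi>. compose (carrier G) \<xi> \<sigma>)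
          (carrier (character_group H)) (carrier (character_group G))"
  proof (rule bij_betw_byWitness[where f' = "\<lambda>\<xi>. compose (carrier H) \<xi> \<tau>"])
    show "\<forall>\<xi>\<in>carrier (character_group H).
            compose (carrier H) (compose (carrier G) \<xi> \<sigma>) \<tau> = \<xi>"
      using hom_in_carrier[OF hom(2)]
      by (auto intro!: extensionalityI[of _ "carrier H"]
          simp: character_group_def compose_eq \<sigma>\<tau>)
    show "\<forall>\<xi>\<in>carrier (character_group G).
            compose (carrier G) (compose (carrier H) \<xi> \<tau>) \<sigma> = \<xi>"
      using hom_in_carrier[OF hom(1)]
      by (auto intro!: extensionalityI[of _ "carrier G"]
          simp: character_group_def compose_eq \<tau>\<sigma>)
    show "(\<lambda>\<xi>. compose (carrier G) \<xi> \<sigma>) ` carrier (character_group H)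
            \<subseteq> carrier (character_group G)"
      using compose_hom_character[OF hom(1)] by blast
    show "(\<lambda>\<xi>. compose (carrier H) \<xi> \<tau>) ` carrier (character_group G)
            \<subseteq> carrier (character_group H)"
      using group.compose_hom_character[OF H hom(2)] by blast
  qed
  moreover have "(\<lambda>\<xi>. compose (carrier G) \<xi> \<sigma>) \<in> hom (character_group H) (character_group G)"
  proof (rule homI)
    fix \<xi> \<eta>
    show "compose (carrier G) (\<xi> \<otimes>\<^bsub>character_group H\<^esub> \<eta>) \<sigma> =
        compose (carrier G) \<xi> \<sigma> \<otimes>\<^bsub>character_group G\<^esub> compose (carrier G) \<eta> \<sigma>"
      using hom_in_carrier[OF hom(1)]
      by (auto simp: character_group_def compose_def fun_eq_iff)
  qed (rule compose_hom_character[OF hom(1)])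
  ultimately show ?thesis
    by (simp add: iso_def)
qed

section \<open>Harmonic frames under affine maps\<close>

lemma inj_on_affine:
  assumes "\<sigma> \<in> iso G G" and "b \<in> carrier G" and "J \<subseteq> carrier G"
  shows "inj_on (\<lambda>g. \<sigma> g \<otimes> inv b) J"
proof (rule inj_onI)
  fix x y
  assume xy: "x \<in> J" "y \<in> J" and eq: "\<sigma> x \<otimes> inv b = \<sigma> y \<otimes> inv b"
  have bij: "bij_betw \<sigma> (carrier G) (carrier G)"
    using assms(1) by (simp add: iso_def)
  have "x \<in> carrier G" "y \<in> carrier G"
    using xy assms(3) by auto
  moreover from this have "\<sigma> x = \<sigma> y"
    using eq assms(2) bij by (metis bij_betwE inv_closed right_cancel)
  ultimately show "x = y"
    using bij by (metis bij_betw_inv_into_left)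
qed

text \<open>The computation shared by all three claims. At
  \<open>k = \<sigma> j \<otimes> inv b\<close> multiplicativity splits off the factor
  \<open>\<eta> (inv b)\<close>, and injectivity of the affine map recovers \<open>j\<close> from
  \<open>k\<close>. Keeping \<open>\<xi>\<close> separate from \<open>\<eta>\<close> covers both the
  translate case, where they coincide, and the reindexed cases.\<close>

lemma harmonic_frame_affine:
  assumes \<sigma>: "\<sigma> \<in> iso G G" and b: "b \<in> carrier G" and J: "J \<subseteq> carrier G"
    and K: "K = (\<lambda>g. \<sigma> g \<otimes> inv b) ` J"
    and \<eta>: "\<eta> \<in> carrier (character_group G)"
    and \<xi>: "\<And>j. j \<in> J \<Longrightarrow> \<eta> (\<sigma> j) = \<xi> j"
  shows "harmonic_frame K \<eta> =
    (\<lambda>k\<in>K. \<eta> (inv b) * harmonic_frame J \<xi> (inv_into J (\<lambda>g. \<sigma> g \<otimes> inv b) k))"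
  unfolding harmonic_frame_def
proof (rule restrict_ext)
  fix k assume "k \<in> K"
  then obtain j where j: "j \<in> J" "k = \<sigma> j \<otimes> inv b"
    using K by blast
  have "\<sigma> j \<in> carrier G"
    using \<sigma> J j(1) by (auto simp: iso_def bij_betw_def)
  then have "\<eta> k = \<eta> (inv b) * \<xi> j"
    using \<eta> b j \<xi> by (simp add: character_mult)
  moreover have "inv_into J (\<lambda>g. \<sigma> g \<otimes> inv b) k = j"
    using inv_into_f_f[OF inj_on_affine[OF \<sigma> b J] j(1)] j(2) by simp
  ultimately show "\<eta> k = \<eta> (inv b) * restrict \<xi> J (inv_into J (\<lambda>g. \<sigma> g \<otimes> inv b) k)"
    using j(1) by simp
qed

text \<open>Relabelling pulls tuples back along a bijection from \<open>K\<close> to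
  \<open>J\<close>, hence the inverse of the affine map.\<close>

lemma bij_betw_inv_affine:
  assumes "\<sigma> \<in> iso G G" and "b \<in> carrier G" and "J \<subseteq> carrier G"
    and "K = (\<lambda>g. \<sigma> g \<otimes> inv b) ` J"
  shows "bij_betw (inv_into J (\<lambda>g. \<sigma> g \<otimes> inv b)) K J"
  using bij_betw_inv_into[OF inj_on_imp_bij_betw[OF inj_on_affine[OF assms(1-3)]]] assms(4)
  by simp

text \<open>Take \<open>\<alpha>\<close> to be pullback along the inverse of
  \<open>\<sigma>\<close>; then \<open>\<sigma>\<close> cancels.\<close>

lemma character_reindex:
  assumes \<sigma>: "\<sigma> \<in> iso G G"
  obtains \<alpha> where "\<alpha> \<in> iso (character_group G) (character_group G)"
    and "\<And>\<xi> g. g \<in> carrier G \<Longrightarrow> \<alpha> \<xi> (\<sigma> g) = \<xi> g"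
proof
  show "(\<lambda>\<xi>. compose (carrier G) \<xi> (inv_into (carrier G) \<sigma>))
      \<in> iso (character_group G) (character_group G)"
    by (rule compose_iso_character_group[OF iso_set_sym[OF \<sigma>] is_group])
  show "compose (carrier G) \<xi> (inv_into (carrier G) \<sigma>) (\<sigma> g) = \<xi> g"
    if "g \<in> carrier G" for g and \<xi> :: "'a \<Rightarrow> complex"
    using \<sigma> that
    by (auto simp: compose_def iso_def bij_betw_inv_into_left dest: bij_betwE)
qed

section \<open>The three equivalences\<close>

lemma translate_imp_projectively_unitarily_equivalent:
  assumes "finite (carrier G)" and J: "J \<subseteq> carrier G" and "translate_of G J K"
  shows "projectively_unitarily_equivalent (carrier (character_group G)) J K
    (harmonic_frame J) (harmonic_frame K)"
proof -
  \<comment> \<open>Writing \<open>id g\<close> exhibits the translation as an affine map whose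
    automorphism fixes every character, so the indices stay put.\<close>
  obtain b where b: "b \<in> carrier G" and K: "K = (\<lambda>g. id g \<otimes> inv b) ` J"
    using assms(3) by (auto simp: translate_of_def)
  have id: "id \<in> iso G G"
    by (auto simp: iso_def hom_def)
  show ?thesis
  proof (rule projectively_unitarily_equivalentI_relabel[OF bij_betw_inv_affine[OF id b J K]])
    fix \<xi> assume \<xi>: "\<xi> \<in> carrier (character_group G)"
    show "norm (\<xi> (inv b)) = 1"
      using assms(1) b \<xi> by (simp add: norm_character)
    show "harmonic_frame K \<xi> =
        (\<lambda>k\<in>K. \<xi> (inv b) * harmonic_frame J \<xi> (inv_into J (\<lambda>g. id g \<otimes> inv b) k))"
      by (rule harmonic_frame_affine[OF id b J K \<xi>]) simp
  qed
qed

lemma multiplicative_imp_unitarily_equivalent: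
  assumes J: "J \<subseteq> carrier G" and "multiplicatively_equivalent G J K"
  shows "unitarily_equivalent_reindex (character_group G) J K
    (harmonic_frame J) (harmonic_frame K)"
proof -
  obtain \<sigma> where \<sigma>: "\<sigma> \<in> iso G G" and "K = \<sigma> ` J"
    using assms(2) by (auto simp: multiplicatively_equivalent_def)
  \<comment> \<open>The automorphism is treated as an affine map with \<open>b = \<one>\<close>; the
    scalar is then the value of a character at \<open>inv \<one>\<close>, which is 1, so the
    equivalence is not merely projective.\<close>
  moreover have "\<sigma> g \<otimes> inv \<one> = \<sigma> g" if "g \<in> J" for g
    using that J \<sigma> by (auto simp: iso_def dest: hom_in_carrier)
  ultimately have K: "K = (\<lambda>g. \<sigma> g \<otimes> inv \<one>) ` J"
    by simp
  obtain \<alpha> where \<alpha>: "\<alpha> \<in> iso (character_group G) (character_group G)"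
    "\<And>\<xi> g. g \<in> carrier G \<Longrightarrow> \<alpha> \<xi> (\<sigma> g) = \<xi> g"
    using character_reindex[OF \<sigma>] by blast
  have char: "\<alpha> \<xi> \<in> carrier (character_group G)" if "\<xi> \<in> carrier (character_group G)" for \<xi>
    using \<alpha>(1) that by (auto simp: iso_def hom_def)
  have "harmonic_frame K (\<alpha> \<xi>) =
      (\<lambda>k\<in>K. harmonic_frame J \<xi> (inv_into J (\<lambda>g. \<sigma> g \<otimes> inv \<one>) k))"
    if "\<xi> \<in> carrier (character_group G)" for \<xi>
  proof -
    have "\<alpha> \<xi> (\<sigma> j) = \<xi> j" if "j \<in> J" for j
      using \<alpha>(2) J that by blast
    from harmonic_frame_affine[OF \<sigma> one_closed J K char[OF that] this]
    show ?thesis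
      using character_one[OF char[OF that]] by simp
  qed
  then have "unitarily_equivalent (carrier (character_group G)) J K
      (harmonic_frame J) (\<lambda>\<xi>. harmonic_frame K (\<alpha> \<xi>))"
    by (rule unitarily_equivalentI_relabel[OF bij_betw_inv_affine[OF \<sigma> one_closed J K]])
  with \<alpha>(1) show ?thesis
    unfolding unitarily_equivalent_reindex_def by blast
qed

lemma affine_imp_projectively_unitarily_equivalent:
  assumes "finite (carrier G)" and J: "J \<subseteq> carrier G" and "affinely_equivalent G J K"
  shows "projectively_unitarily_equivalent_reindex (character_group G) J K
    (harmonic_frame J) (harmonic_frame K)"
proof -
  obtain \<sigma> b where \<sigma>: "\<sigma> \<in> iso G G" and b: "b \<in> carrier G"
    and K: "K = (\<lambda>g. \<sigma> g \<otimes> inv b) ` J"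
    using assms(3) by (auto simp: affinely_equivalent_def)
  obtain \<alpha> where \<alpha>: "\<alpha> \<in> iso (character_group G) (character_group G)"
    "\<And>\<xi> g. g \<in> carrier G \<Longrightarrow> \<alpha> \<xi> (\<sigma> g) = \<xi> g"
    using character_reindex[OF \<sigma>] by blast
  have char: "\<alpha> \<xi> \<in> carrier (character_group G)" if "\<xi> \<in> carrier (character_group G)" for \<xi>
    using \<alpha>(1) that by (auto simp: iso_def hom_def)
  have "projectively_unitarily_equivalent (carrier (character_group G)) J K
      (harmonic_frame J) (\<lambda>\<xi>. harmonic_frame K (\<alpha> \<xi>))"
  \<comment> \<open>The scalar at index \<open>\<xi>\<close> is the value at \<open>inv b\<close> of
    the reindexed character \<open>\<alpha> \<xi>\<close>, not of \<open>\<xi>\<close>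
    itself.\<close>
  proof (rule projectively_unitarily_equivalentI_relabel[OF bij_betw_inv_affine[OF \<sigma> b J K]])
    fix \<xi> assume \<xi>: "\<xi> \<in> carrier (character_group G)"
    show "norm (\<alpha> \<xi> (inv b)) = 1"
      using assms(1) b char[OF \<xi>] by (simp add: norm_character)
    have "\<alpha> \<xi> (\<sigma> j) = \<xi> j" if "j \<in> J" for j
      using \<alpha>(2) J that by blast
    then show "harmonic_frame K (\<alpha> \<xi>) =
        (\<lambda>k\<in>K. \<alpha> \<xi> (inv b) * harmonic_frame J \<xi> (inv_into J (\<lambda>g. \<sigma> g \<otimes> inv b) k))"
      by (rule harmonic_frame_affine[OF \<sigma> b J K char[OF \<xi>]])
  qed
  with \<alpha>(1) show ?thesis
    unfolding projectively_unitarily_equivalent_reindex_def by blast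
qed

end

theorem theorem6p2:
  fixes G :: "('a, 'm) monoid_scheme" and J K :: "'a set"
  assumes "comm_group G" and "finite (carrier G)"
    and "J \<subseteq> carrier G" and "K \<subseteq> carrier G"
  shows
    "(translate_of G J K \<longrightarrow>
        projectively_unitarily_equivalent (carrier (character_group G)) J K
          (harmonic_frame J) (harmonic_frame K)) \<and>
     (multiplicatively_equivalent G J K \<longrightarrow>
        unitarily_equivalent_reindex (character_group G) J K
          (harmonic_frame J) (harmonic_frame K)) \<and>
     (affinely_equivalent G J K \<longrightarrow>
        projectively_unitarily_equivalent_reindex (character_group G) J K
          (harmonic_frame J) (harmonic_frame K))"
proof -
  interpret comm_group G by fact
  show ?thesis
    using assms(2,3) translate_imp_projectively_unitarily_equivalent
      multiplicative_imp_unitarily_equivalent affine_imp_projectively_unitarily_equivalent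
    by blast
qed

end
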